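(* Let $0\le c<1/2$ and let $(p_n)_{n\ge1}$ be a sequence in $[0,1]$ with $p_n=\Omega(n^{-c})$, and for each $n$ let $G_n$ be a random graph drawn from the Erdős–Rényi distribution $G(n,p_n)$. Then for all $\epsilon>0$ and $\delta>0$ there exists $N$ such that for all $n\ge N$, $$P[\mathrm{GAPEB}(G_n)<1+\delta]>1-\epsilon.$$
   Context: $p_n=\Omega(n^{-c})$ means there exist $k>0$ and $n_0$ with $p_n \ge k n^{-c}$ for all $n\ge n_0$. The distribution $G(n,p)$ on graphs with vertex set of size $n$ includes each of the $\binom{n}{2}$ possible edges independently with probability $p$. For an undirected graph $G=(V,E)$ with $|V|=n$, a layout is a bijection $\phi:V\to\{1,\dots,n\}$. For $1\le i\le n$, $\theta(i,\phi,G)$ is the number of edges $uv\in E$ with $\phi(u)\le i<\phi(v)$. Define $\mathrm{EB}(G,\phi)=\theta(\lfloor n/2\rfloor,\phi,G)$, $\mathrm{MINEB}(G)=\min_\phi\mathrm{EB}(G,\phi)$, $\mathrm{MAXEB}(G)=\max_\phi\mathrm{EB}(G,\phi)$ over all layouts $\phi$, and $\mathrm{GAPEB}(G)=\mathrm{MAXEB}(G)/\mathrm{MINEB}(G)$. *)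

theory Defs
  imports "HOL-Probability.Probability" "HOL-Probability.Product_PMF" "HOL-Library.Landau_Symbols"
begin

text \<open>An undirected simple graph is a pair of a vertex set and a set of two-element vertex sets.\<close>

type_synonym 'a graph = "'a set \<times> 'a set set"

definition possible_edges :: "'a set \<Rightarrow> 'a set set" where
  "possible_edges V = {e. e \<subseteq> V \<and> card e = 2}"

text \<open>The vertex set of size \<open>n\<close> is taken to be \<open>{1..n}\<close>; the independent indicators
  \<open>b e\<close> decide which edges are present.\<close>

definition Gnp :: "nat \<Rightarrow> real \<Rightarrow> nat graph pmf" where
  "Gnp n p =
    map_pmf (\<lambda>b. ({1..n}, {e \<in> possible_edges {1..n}. b e}))
      (Pi_pmf (possible_edges {1..n}) False (\<lambda>_. bernoulli_pmf p))"

definition layouts :: "'a graph \<Rightarrow> ('a \<Rightarrow> nat) set" where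
  "layouts G = {\<phi>. bij_betw \<phi> (fst G) {1..card (fst G)}}"

definition theta :: "nat \<Rightarrow> ('a \<Rightarrow> nat) \<Rightarrow> 'a graph \<Rightarrow> nat" where
  "theta i \<phi> G = card {e \<in> snd G. \<exists>u v. e = {u, v} \<and> \<phi> u \<le> i \<and> i < \<phi> v}"

definition EB :: "'a graph \<Rightarrow> ('a \<Rightarrow> nat) \<Rightarrow> nat" where
  "EB G \<phi> = theta (card (fst G) div 2) \<phi> G"

definition MINEB :: "'a graph \<Rightarrow> nat" where
  "MINEB G = Min (EB G ` layouts G)"

definition MAXEB :: "'a graph \<Rightarrow> nat" where
  "MAXEB G = Max (EB G ` layouts G)"

text \<open>\<open>Min\<close> and \<open>Max\<close> above range over a finite nonempty set: layouts are total functions, so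
  there may be infinitely many of them, but they attain only finitely many values.\<close>

lemma finite_EB_layouts:
  assumes "finite (snd G)"
  shows "finite (EB G ` layouts G)"
proof (rule finite_subset)
  show "EB G ` layouts G \<subseteq> {..card (snd G)}"
    using assms by (auto simp: EB_def theta_def intro!: card_mono)
qed simp

lemma EB_layouts_nonempty:
  assumes "finite (fst G)"
  shows "EB G ` layouts G \<noteq> {}"
proof -
  have "\<exists>\<phi>. bij_betw \<phi> (fst G) {1..card (fst G)}"
    using assms by (intro finite_same_card_bij) auto
  then show ?thesis by (auto simp: layouts_def)
qed

text \<open>The quotient is undefined when \<open>MINEB G = 0\<close>. HOL division would then return \<open>0\<close> and
  make every upper bound on the gap true, so the value \<open>\<infinity>\<close> is used instead.\<close>

definition GAPEB :: "'a graph \<Rightarrow> ereal" where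
  "GAPEB G = (if MINEB G = 0 then \<infinity> else ereal (real (MAXEB G) / real (MINEB G)))"

end

theory Submission
  imports Defs "HOL-Real_Asymp.Real_Asymp"
begin

text \<open>A bisection is a cut \<open>(S, V - S)\<close> with \<open>\<lfloor>n/2\<rfloor>\<close> vertices in \<open>S\<close>; it has
  \<open>m = \<lfloor>n/2\<rfloor>\<lceil>n/2\<rceil> \<ge> n\<^sup>2/8\<close> possible edges, and the number of those present is binomial with
  parameters \<open>m\<close> and \<open>p\<close>. By Hoeffding's inequality it deviates from \<open>m p\<close> by a factor outside
  \<open>(1 - t, 1 + t)\<close> with probability at most \<open>2 exp (- 2 m t\<^sup>2 p\<^sup>2)\<close>. For \<open>p \<ge> k n\<^sup>-\<^sup>c\<close> with
  \<open>c < 1/2\<close> the exponent grows faster than \<open>n\<close>, so the union bound over the at most \<open>2\<^sup>n\<close>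
  bisections still tends to \<open>0\<close>. The value \<open>t = \<delta> / (2 + \<delta>)\<close> solves \<open>(1 + t) / (1 - t) = 1 + \<delta>\<close>.\<close>

text \<open>Written as an image of pairs so that counting is a product: the two sides are disjoint,
  hence each edge arises from exactly one pair.\<close>

definition cut_edges :: "'a set \<Rightarrow> 'a set \<Rightarrow> 'a set set" where
  "cut_edges V S = (\<lambda>(u, v). {u, v}) ` (S \<times> (V - S))"

lemma finite_possible_edges: "finite V \<Longrightarrow> finite (possible_edges V)"
  unfolding possible_edges_def by (rule finite_subset[of _ "Pow V"]) auto

lemma cut_edges_subset: "S \<subseteq> V \<Longrightarrow> cut_edges V S \<subseteq> possible_edges V"
  by (auto simp: cut_edges_def possible_edges_def card_2_iff)

lemma card_cut_edges:
  assumes "S \<subseteq> V"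
  shows "card (cut_edges V S) = card S * card (V - S)"
proof -
  have "inj_on (\<lambda>(u, v). {u, v}) (S \<times> (V - S))"
    by (auto simp: inj_on_def doubleton_eq_iff)
  then show ?thesis
    by (simp add: cut_edges_def card_image card_cartesian_product)
qed

text \<open>A layout matters only through the set of vertices in its first half, which is the
  witness for \<open>S\<close>. This replaces the \<open>n!\<close> orderings by at most
  \<open>2 ^ n\<close> sets in the union bound.\<close>

lemma EB_eq_card_cut:
  assumes "finite V" and E: "E \<subseteq> possible_edges V" and \<phi>: "\<phi> \<in> layouts (V, E)"
  obtains S where "S \<subseteq> V" "card S = card V div 2" "EB (V, E) \<phi> = card (cut_edges V S \<inter> E)"
proof
  let ?h = "card V div 2"
  let ?S = "{v \<in> V. \<phi> v \<le> ?h}"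
  have bij: "bij_betw \<phi> V {1..card V}"
    using \<phi> by (simp add: layouts_def)
  have "\<phi> ` ?S = {1..?h}"
  proof
    show "\<phi> ` ?S \<subseteq> {1..?h}"
      using bij by (auto simp: bij_betw_def)
    show "{1..?h} \<subseteq> \<phi> ` ?S"
    proof
      fix i assume i: "i \<in> {1..?h}"
      then have "i \<in> \<phi> ` V"
        using bij by (auto simp: bij_betw_def)
      then show "i \<in> \<phi> ` ?S" using i by auto
    qed
  qed
  moreover have "inj_on \<phi> ?S"
    using bij by (auto simp: bij_betw_def inj_on_def)
  ultimately show "card ?S = ?h"
    using card_image[of \<phi> ?S] by simp
  have "{e \<in> E. \<exists>u v. e = {u, v} \<and> \<phi> u \<le> ?h \<and> ?h < \<phi> v} = cut_edges V ?S \<inter> E"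
  proof (intro equalityI subsetI)
    fix e assume "e \<in> {e \<in> E. \<exists>u v. e = {u, v} \<and> \<phi> u \<le> ?h \<and> ?h < \<phi> v}"
    then obtain u v where e: "e \<in> E" "e = {u, v}" "\<phi> u \<le> ?h" "?h < \<phi> v" by blast
    \<comment> \<open>A layout is arbitrary outside \<open>V\<close>, so its values cannot locate
      the endpoints; membership in \<open>E\<close> does.\<close>
    moreover have "u \<in> V" "v \<in> V"
      using e E by (auto simp: possible_edges_def)
    ultimately show "e \<in> cut_edges V ?S \<inter> E"
      by (force simp: cut_edges_def)
  next
    fix e assume "e \<in> cut_edges V ?S \<inter> E"
    then show "e \<in> {e \<in> E. \<exists>u v. e = {u, v} \<and> \<phi> u \<le> ?h \<and> ?h < \<phi> v}"
      by (fastforce simp: cut_edges_def)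
  qed
  then show "EB (V, E) \<phi> = card (cut_edges V ?S \<inter> E)"
    by (simp add: EB_def theta_def)
qed auto

text \<open>The deterministic half of the argument: minimum and maximum are attained at layouts, so
  both inherit the two-sided bound on cuts around the common value \<open>q\<close>, later the mean
  \<open>m p\<close>.\<close>

lemma GAPEB_less:
  assumes fin: "finite V" and E: "E \<subseteq> possible_edges V" and \<delta>: "\<delta> > 0" and q: "q > 0"
    and cut: "\<And>S. S \<subseteq> V \<Longrightarrow> card S = card V div 2 \<Longrightarrow>
      \<bar>real (card (cut_edges V S \<inter> E)) - q\<bar> < \<delta> / (2 + \<delta>) * q"
  shows "GAPEB (V, E) < ereal (1 + \<delta>)"
proof -
  define t where "t = \<delta> / (2 + \<delta>)"
  have t: "0 < t" "t < 1" "1 + t = (1 + \<delta>) * (1 - t)"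
    using \<delta> by (auto simp: t_def field_simps)
  have EB: "real (EB (V, E) \<phi>) > (1 - t) * q" "real (EB (V, E) \<phi>) < (1 + t) * q"
    if \<phi>: "\<phi> \<in> layouts (V, E)" for \<phi>
  proof -
    obtain S where S: "S \<subseteq> V" "card S = card V div 2"
      "EB (V, E) \<phi> = card (cut_edges V S \<inter> E)"
      using EB_eq_card_cut[OF fin E \<phi>] .
    then have "\<bar>real (EB (V, E) \<phi>) - q\<bar> < t * q"
      using cut unfolding t_def by metis
    then show "real (EB (V, E) \<phi>) > (1 - t) * q" "real (EB (V, E) \<phi>) < (1 + t) * q"
      by (auto simp: algebra_simps abs_less_iff)
  qed
  have "finite E"
    using E finite_possible_edges[OF fin] finite_subset by blast
  then have F: "finite (EB (V, E) ` layouts (V, E))" "EB (V, E) ` layouts (V, E) \<noteq> {}"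
    using finite_EB_layouts[of "(V, E)"] EB_layouts_nonempty[of "(V, E)"] fin by auto
  obtain \<phi> where "\<phi> \<in> layouts (V, E)" "MINEB (V, E) = EB (V, E) \<phi>"
    using Min_in[OF F] unfolding MINEB_def by auto
  then have min: "real (MINEB (V, E)) > (1 - t) * q"
    using EB by simp
  obtain \<psi> where "\<psi> \<in> layouts (V, E)" "MAXEB (V, E) = EB (V, E) \<psi>"
    using Max_in[OF F] unfolding MAXEB_def by auto
  then have "real (MAXEB (V, E)) < (1 + t) * q"
    using EB by simp
  also have "\<dots> = (1 + \<delta>) * ((1 - t) * q)"
    by (simp add: t(3))
  also have "\<dots> < (1 + \<delta>) * real (MINEB (V, E))"
    using min \<delta> by simp
  finally have less: "real (MAXEB (V, E)) < (1 + \<delta>) * real (MINEB (V, E))" .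
  \<comment> \<open>Forces \<open>MINEB\<close> to be positive, which rules out the value
    \<open>\<infinity>\<close> in \<open>GAPEB\<close>.\<close>
  moreover have "(1 - t) * q > 0"
    using t q by simp
  ultimately show ?thesis
    using min by (simp add: GAPEB_def divide_less_eq)
qed

text \<open>The number of successes within \<open>C\<close> is binomial, so Hoeffding's inequality
  applies. The ambient \<open>A\<close> keeps the events for different \<open>C\<close> in one
  probability space, as the union bound requires.\<close>

lemma prob_bernoulli_subset_deviation:
  fixes p \<epsilon> :: real
  assumes "finite A" "C \<subseteq> A" "C \<noteq> {}" "p \<in> {0..1}" "\<epsilon> \<ge> 0"
  shows "measure_pmf.prob (Pi_pmf A False (\<lambda>_. bernoulli_pmf p))
      {b. \<bar>real (card {x \<in> C. b x}) / real (card C) - p\<bar> \<ge> \<epsilon>}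
    \<le> 2 * exp (- 2 * real (card C) * \<epsilon>\<^sup>2)"
proof -
  have C: "finite C" "card C > 0"
    using assms finite_subset by (auto simp: card_gt_0_iff)
  have "binomial_pmf (card C) p =
      map_pmf (\<lambda>b. card {x \<in> C. b x}) (Pi_pmf C False (\<lambda>_. bernoulli_pmf p))"
    using C assms by (intro binomial_pmf_altdef') auto
  \<comment> \<open>Restricting the product from \<open>A\<close> to \<open>C\<close> resets the
    coordinates outside \<open>C\<close> to \<open>False\<close>, which the count over
    \<open>C\<close> does not see.\<close>
  also have "\<dots> = map_pmf (\<lambda>b. card {x \<in> C. b x}) (Pi_pmf A False (\<lambda>_. bernoulli_pmf p))"
    unfolding Pi_pmf_subset[OF assms(1,2)] map_pmf_comp
    by (intro map_pmf_cong refl arg_cong[of _ _ card]) auto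
  finally have binomial: "binomial_pmf (card C) p =
      map_pmf (\<lambda>b. card {x \<in> C. b x}) (Pi_pmf A False (\<lambda>_. bernoulli_pmf p))" .
  have "measure_pmf.prob (Pi_pmf A False (\<lambda>_. bernoulli_pmf p))
      {b. \<bar>real (card {x \<in> C. b x}) / real (card C) - p\<bar> \<ge> \<epsilon>} =
      measure_pmf.prob (binomial_pmf (card C) p) {x. \<bar>real x / real (card C) - p\<bar> \<ge> \<epsilon>}"
    by (simp add: binomial vimage_def)
  also have "\<dots> \<le> 2 * exp (- 2 * real (card C) * \<epsilon>\<^sup>2)"
    using binomial_distribution.prob_abs_ge'[of p "card C" \<epsilon>] C assms
    by (simp add: binomial_distribution_def)
  finally show ?thesis .
qed

lemma half_mult_half_ge:
  assumes "n \<ge> 2"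
  shows "real ((n div 2) * (n - n div 2)) \<ge> (real n)\<^sup>2 / 8"
proof -
  obtain k where "n = 2 * k \<or> n = 2 * k + 1" by (metis evenE oddE)
  moreover have "k \<ge> 1" using assms calculation by auto
  \<comment> \<open>This is the odd case \<open>n = 2 * k + 1\<close>, where
    \<open>k * (k + 1) \<ge> (2 * k + 1)\<^sup>2 / 8\<close> reduces to
    \<open>4 * k + 4 * k\<^sup>2 \<ge> 1\<close>.\<close>
  moreover have "1 \<le> real k * 4 + real k * (real k * 4)"
    using \<open>k \<ge> 1\<close> by (intro add_increasing2) auto
  ultimately show ?thesis
    by (elim disjE; simp add: power2_eq_square algebra_simps)
qed

lemma prob_GAPEB_less:
  fixes p \<delta> :: real
  assumes n: "n \<ge> 2" and p: "0 < p" "p \<le> 1" and \<delta>: "\<delta> > 0"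
  shows "measure_pmf.prob (Gnp n p) {G. GAPEB G < ereal (1 + \<delta>)}
    \<ge> 1 - 2 ^ n * (2 * exp (- 2 * ((real n)\<^sup>2 / 8) * (\<delta> / (2 + \<delta>) * p)\<^sup>2))"
proof -
  define V where "V = {1..n}"
  define t where "t = \<delta> / (2 + \<delta>)"
  define m where "m = (n div 2) * (n - n div 2)"
  define P where "P = Pi_pmf (possible_edges V) False (\<lambda>_. bernoulli_pmf p)"
  define \<S> where "\<S> = {S. S \<subseteq> V \<and> card S = n div 2}"
  define bad where "bad S = {b. \<bar>real (card {e \<in> cut_edges V S. b e}) / real m - p\<bar> \<ge> t * p}" for S
  have V: "finite V" "card V = n" by (auto simp: V_def)
  have m: "m > 0" "real m \<ge> (real n)\<^sup>2 / 8"
    using n half_mult_half_ge[OF n] by (auto simp: m_def)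
  have t: "t > 0" using \<delta> by (simp add: t_def)
  have \<S>: "\<S> \<subseteq> Pow V" by (auto simp: \<S>_def)
  then have fin\<S>: "finite \<S>" using V finite_subset by blast
  have card\<S>: "card \<S> \<le> 2 ^ n"
    using card_mono[OF _ \<S>] V by (simp add: card_Pow)
  have card_cut: "card (cut_edges V S) = m" if "S \<in> \<S>" for S
    using that V by (auto simp: \<S>_def m_def card_cut_edges card_Diff_subset finite_subset)
  have bad_le: "measure_pmf.prob P (bad S) \<le> 2 * exp (- 2 * ((real n)\<^sup>2 / 8) * (t * p)\<^sup>2)"
    if S: "S \<in> \<S>" for S
  proof -
    have "measure_pmf.prob P (bad S) \<le> 2 * exp (- 2 * real m * (t * p)\<^sup>2)"
      using prob_bernoulli_subset_deviation[of "possible_edges V" "cut_edges V S" p "t * p"]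
        finite_possible_edges[OF V(1)] cut_edges_subset[of S V] card_cut[OF S] S m p t
      unfolding P_def bad_def \<S>_def by force
    also have "\<dots> \<le> 2 * exp (- 2 * ((real n)\<^sup>2 / 8) * (t * p)\<^sup>2)"
      using mult_right_mono[OF m(2), of "(t * p)\<^sup>2"] by simp
    finally show ?thesis .
  qed
  \<comment> \<open>Outside all bad events, multiplying the density deviation by \<open>m\<close>
    gives the hypothesis of \<open>GAPEB_less\<close> with \<open>q = m p\<close>.\<close>
  have "GAPEB (V, {e \<in> possible_edges V. b e}) < ereal (1 + \<delta>)" if b: "b \<notin> (\<Union>S\<in>\<S>. bad S)" for b
  proof (rule GAPEB_less[where q = "real m * p"])
    fix S assume S: "S \<subseteq> V" "card S = card V div 2"
    then have S': "S \<in> \<S>" by (auto simp: \<S>_def V)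
    have eq: "cut_edges V S \<inter> {e \<in> possible_edges V. b e} = {e \<in> cut_edges V S. b e}"
      using cut_edges_subset[OF S(1)] by auto
    have "\<bar>real (card {e \<in> cut_edges V S. b e}) / real m - p\<bar> < t * p"
      using b S' by (auto simp: bad_def)
    then have "real m * \<bar>real (card {e \<in> cut_edges V S. b e}) / real m - p\<bar> < real m * (t * p)"
      using m by simp
    also have "real m * \<bar>real (card {e \<in> cut_edges V S. b e}) / real m - p\<bar> =
        \<bar>real m * (real (card {e \<in> cut_edges V S. b e}) / real m - p)\<bar>"
      by (simp add: abs_mult)
    also have "real m * (real (card {e \<in> cut_edges V S. b e}) / real m - p) =
        real (card {e \<in> cut_edges V S. b e}) - real m * p"
      using m by (simp add: right_diff_distrib)
    finally show "\<bar>real (card (cut_edges V S \<inter> {e \<in> possible_edges V. b e})) - real m * p\<bar>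
        < \<delta> / (2 + \<delta>) * (real m * p)"
      unfolding eq by (simp add: t_def mult_ac)
  qed (use V \<delta> m p in auto)
  then have "- (\<Union>S\<in>\<S>. bad S) \<subseteq>
      {b. GAPEB (V, {e \<in> possible_edges V. b e}) < ereal (1 + \<delta>)}" by blast
  then have "measure_pmf.prob P (- (\<Union>S\<in>\<S>. bad S)) \<le>
      measure_pmf.prob P {b. GAPEB (V, {e \<in> possible_edges V. b e}) < ereal (1 + \<delta>)}"
    by (intro measure_pmf.finite_measure_mono) auto
  also have "\<dots> = measure_pmf.prob (Gnp n p) {G. GAPEB G < ereal (1 + \<delta>)}"
    by (simp add: Gnp_def P_def V_def vimage_def)
  finally have "measure_pmf.prob (Gnp n p) {G. GAPEB G < ereal (1 + \<delta>)} \<ge>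
      1 - measure_pmf.prob P (\<Union>S\<in>\<S>. bad S)"
    using measure_pmf.prob_compl[of "\<Union>S\<in>\<S>. bad S" P] by (simp add: Compl_eq_Diff_UNIV)
  moreover have "measure_pmf.prob P (\<Union>S\<in>\<S>. bad S) \<le> (\<Sum>S\<in>\<S>. measure_pmf.prob P (bad S))"
    using fin\<S> by (intro measure_pmf.finite_measure_subadditive_finite) auto
  moreover have "\<dots> \<le> real (card \<S>) * (2 * exp (- 2 * ((real n)\<^sup>2 / 8) * (t * p)\<^sup>2))"
    using bad_le by (intro sum_bounded_above) auto
  moreover have "\<dots> \<le> 2 ^ n * (2 * exp (- 2 * ((real n)\<^sup>2 / 8) * (t * p)\<^sup>2))"
    using of_nat_mono[OF card\<S>, where 'a = real] by (intro mult_right_mono) simp_all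
  ultimately show ?thesis
    unfolding t_def by linarith
qed

text \<open>Merging \<open>2 ^ n\<close> into the exponential leaves \<open>n\<close> times
  \<open>ln 2\<close> minus a positive multiple of \<open>n powr (1 - 2 * c)\<close>. As
  \<open>c < 1/2\<close>, that power tends to infinity and the exponent to minus infinity.\<close>

lemma union_bound_tendsto_0:
  fixes a c :: real
  assumes "a > 0" "c < 1/2"
  shows "(\<lambda>n. 2 ^ n * (2 * exp (- 2 * ((real n)\<^sup>2 / 8) * (a * real n powr (-c))\<^sup>2))) \<longlonglongrightarrow> 0"
proof -
  have "eventually (\<lambda>n. 2 * exp (real n * (ln 2 - a\<^sup>2 / 4 * real n powr (1 - 2 * c))) =
      2 ^ n * (2 * exp (- 2 * ((real n)\<^sup>2 / 8) * (a * real n powr (-c))\<^sup>2))) sequentially"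
    using eventually_gt_at_top[of 0]
  proof eventually_elim
    case (elim n)
    have powr: "real n powr (1 - 2 * c) = (real n powr (-c))\<^sup>2 * real n"
      using elim by (simp add: power2_eq_square powr_add[symmetric] powr_mult_base mult.commute)
    have "real n * (a\<^sup>2 / 4 * real n powr (1 - 2 * c)) =
        2 * ((real n)\<^sup>2 / 8) * (a * real n powr (-c))\<^sup>2"
      unfolding powr by (simp add: power2_eq_square)
    moreover have "exp (real n * ln 2) = 2 ^ n"
      by (simp add: exp_of_nat_mult)
    ultimately show ?case
      by (simp only: right_diff_distrib exp_diff exp_minus mult_minus_left mult_minus_right divide_inverse mult_ac)
  qed
  moreover have "(\<lambda>n. 2 * exp (real n * (ln 2 - a\<^sup>2 / 4 * real n powr (1 - 2 * c)))) \<longlonglongrightarrow> 0"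
    using assms by real_asymp
  ultimately show ?thesis
    by (rule Lim_transform_eventually[rotated])
qed

theorem theorem3:
  fixes c :: real and p :: "nat \<Rightarrow> real"
  assumes "0 \<le> c" and "c < 1/2"
    and "\<And>n. n \<ge> 1 \<Longrightarrow> p n \<in> {0..1}"
    and "p \<in> \<Omega>(\<lambda>n. real n powr (-c))"
  shows "\<forall>\<epsilon>>0. \<forall>\<delta>>0. \<exists>N. \<forall>n\<ge>N.
    measure_pmf.prob (Gnp n (p n)) {G. GAPEB G < ereal (1 + \<delta>)} > 1 - \<epsilon>"
proof (intro allI impI)
  fix \<epsilon> \<delta> :: real assume \<epsilon>: "\<epsilon> > 0" and \<delta>: "\<delta> > 0"
  define t where "t = \<delta> / (2 + \<delta>)"
  have t: "t > 0" using \<delta> by (simp add: t_def)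
  obtain k where k: "k > 0"
    and ev: "eventually (\<lambda>n. norm (p n) \<ge> k * norm (real n powr (-c))) sequentially"
    using landau_omega.bigE[OF assms(4)] .
  have "eventually (\<lambda>n. 2 ^ n * (2 * exp (- 2 * ((real n)\<^sup>2 / 8) * (t * k * real n powr (-c))\<^sup>2)) < \<epsilon>)
      sequentially"
    using order_tendstoD(2)[OF union_bound_tendsto_0 \<epsilon>] t k assms(2) by simp
  then have "eventually (\<lambda>n. measure_pmf.prob (Gnp n (p n)) {G. GAPEB G < ereal (1 + \<delta>)} > 1 - \<epsilon>)
      sequentially"
    using ev eventually_ge_at_top[of 2]
  proof eventually_elim
    case (elim n)
    have pn: "0 \<le> p n" "p n \<le> 1" using assms(3)[of n] elim by auto
    \<comment> \<open>The asymptotic bound concerns \<open>norm (p n)\<close>; nonnegativity of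
      \<open>p n\<close> turns it into a lower bound on \<open>p n\<close> itself.\<close>
    then have le: "k * real n powr (-c) \<le> p n" using elim by simp
    moreover have "k * real n powr (-c) > 0" using k elim by simp
    ultimately have pos: "p n > 0" by linarith
    \<comment> \<open>The failure bound decreases in the edge probability, so \<open>p n\<close> may
      be replaced by its lower bound; the limit is then used with \<open>a = t * k\<close>.\<close>
    have "(t * k * real n powr (-c))\<^sup>2 \<le> (t * p n)\<^sup>2"
      using le t k by (intro power_mono) (auto simp: mult.assoc)
    then have "2 ^ n * (2 * exp (- 2 * ((real n)\<^sup>2 / 8) * (t * p n)\<^sup>2)) \<le>
        2 ^ n * (2 * exp (- 2 * ((real n)\<^sup>2 / 8) * (t * k * real n powr (-c))\<^sup>2))"
      by (simp add: mult_left_mono)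
    also have "\<dots> < \<epsilon>" using elim by simp
    finally show ?case
      using prob_GAPEB_less[of n "p n" \<delta>] elim pos pn \<delta> unfolding t_def by linarith
  qed
  then show "\<exists>N. \<forall>n\<ge>N. measure_pmf.prob (Gnp n (p n)) {G. GAPEB G < ereal (1 + \<delta>)} > 1 - \<epsilon>"
    by (simp add: eventually_sequentially)
qed

end
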